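(* Let $\epsilon = 1/12$ and consider an allocation process on $n$ bins with a probability vector $p = (p_1, \ldots, p_n)$ that is (i) non-decreasing in $i$, i.e. $p_i \leq p_{i+1}$, and (ii) satisfies $p_{n/3} \leq \frac{1-4\epsilon}{n}$ and $p_{2n/3} \geq \frac{1+4\epsilon}{n}$. Let $\alpha_2 := 0.0002$ and $c := 2 \cdot 40 \cdot 128^3 \cdot \epsilon^{-7} \cdot 4 \cdot \alpha_2^{-1}$. Then for any $t \geq 0$, \[ \Pr\Big[ \bigcap_{s \in [t, t + n \log^5 n]} \{ \Phi_0^{(s)} \leq 2cn \} \Big] \geq 1 - n^{-3}, \] where $\Phi_0^{(s)} := \sum_{i=1}^n \exp\big( \alpha_2 \cdot (x_i^{(s)} - s/n)^{+} \big)$ and $z^+ = \max(z,0)$.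
   Context: Balls are allocated sequentially into $n$ bins, starting from all loads $0$; $x_i^{(s)}$ is the load of bin $i$ after $s$ balls. An allocation process with probability vector $p$ places, at each step, the ball into the $i$-th most loaded bin (with respect to the current load vector sorted in non-increasing order, ties broken arbitrarily) with probability $p_i$, where $\sum_i p_i = 1$. As throughout the paper, $n$ is assumed sufficiently large. *)

theory Defs
  imports "HOL-Probability.Probability" "HOL-Combinatorics.Permutations"
begin

text \<open>
  Bins are numbered \<open>1..n\<close>. A history is the list of the bins chosen by the balls placed so far,
  in order of time; the load of a bin is the number of its occurrences in the history.
\<close>

definition load :: "nat list \<Rightarrow> nat \<Rightarrow> nat" where
  "load h i = count_list h i"

text \<open>
  \<open>\<pi> \<in> load_orders n x\<close> lists the bins by non-increasing load: \<open>\<pi> i\<close> is the \<open>i\<close>-th most loaded bin.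
  The freedom in the choice of \<open>\<pi>\<close> is exactly the freedom in breaking ties.
\<close>

definition load_orders :: "nat \<Rightarrow> (nat \<Rightarrow> nat) \<Rightarrow> (nat \<Rightarrow> nat) set" where
  "load_orders n x = {\<pi>. \<pi> permutes {1..n} \<and> antimono_on {1..n} (\<lambda>i. x (\<pi> i))}"

text \<open>
  Ties may be broken arbitrarily: the order used for the next ball may depend on the whole history
  and may involve additional randomness.
\<close>

definition tie_breaking_rule :: "nat \<Rightarrow> (nat list \<Rightarrow> (nat \<Rightarrow> nat) pmf) \<Rightarrow> bool" where
  "tie_breaking_rule n \<tau> \<longleftrightarrow> (\<forall>h\<in>lists {1..n}. set_pmf (\<tau> h) \<subseteq> load_orders n (load h))"

text \<open>
  The law of the history after \<open>s\<close> balls. The probability vector is given as the distribution \<open>p\<close>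
  of the rank, i.e. \<open>p\<^sub>i = pmf p i\<close>; the rank is drawn independently of the history and of the
  tie-breaking.
\<close>

primrec allocation :: "(nat list \<Rightarrow> (nat \<Rightarrow> nat) pmf) \<Rightarrow> nat pmf \<Rightarrow> nat \<Rightarrow> nat list pmf" where
  "allocation \<tau> p 0 = return_pmf []"
| "allocation \<tau> p (Suc s) =
     do { h \<leftarrow> allocation \<tau> p s; \<pi> \<leftarrow> \<tau> h; i \<leftarrow> p; return_pmf (h @ [\<pi> i]) }"

definition Phi0 :: "real \<Rightarrow> nat \<Rightarrow> (nat \<Rightarrow> nat) \<Rightarrow> nat \<Rightarrow> real" where
  "Phi0 \<alpha> n x s = (\<Sum>i=1..n. exp (\<alpha> * max (real (x i) - real s / real n) 0))"

end

theory Submission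
  imports Defs "HOL-Real_Asymp.Real_Asymp"
begin

text \<open>
  Write \<open>y\<^sub>i = x\<^sub>i - s/n\<close> and \<open>\<Gamma>\<^sub>\<alpha> = \<Sum>\<^sub>i (exp (\<alpha> y\<^sub>i) + exp (-\<alpha> y\<^sub>i))\<close>. Since \<open>p\<close> is biased towards
  the least loaded bins and the \<open>y\<^sub>i\<close> sum to zero, \<open>\<Gamma>\<^sub>\<alpha>\<close> contracts in expectation by a factor
  \<open>1 - \<alpha>/(100n)\<close> up to an additive \<open>\<alpha>\<close>, for every \<open>\<alpha> \<le> 1/100\<close>. For \<open>\<alpha>\<^sub>1 = 1/100\<close> this gives
  \<open>E \<Gamma> \<le> 100n\<close> at all times, so by Markov \<open>\<Gamma> \<le> n\<^sup>1\<^sup>0\<close> throughout a window of polynomial length.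
  For \<open>\<alpha>\<^sub>2 = \<alpha>\<^sub>1/50\<close> each term of \<open>\<Gamma>\<close>, and hence each increment of \<open>\<Gamma>\<close>, is then at most
  \<open>M = n powr (1/5)\<close>. The negative drift therefore carries over to \<open>exp (\<theta> \<Gamma>)\<close> with
  \<open>\<theta> = \<alpha>\<^sub>2/(2M\<^sup>2)\<close>, and as \<open>\<theta> n\<close> is a positive power of \<open>n\<close>, \<open>\<Gamma> > 600n\<close> is superpolynomially unlikely.
\<close>

section \<open>Exponential sums over sorted vectors\<close>

text \<open>A rearrangement argument: since \<open>d\<close> sums to zero, \<open>w\<close> may be
  shifted by its value at the first position where \<open>d\<close> is positive. Monotonicity of
  \<open>w\<close> and the single sign change of \<open>d\<close> then make every product
  nonnegative.\<close>

lemma sum_mult_single_crossing: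
  fixes d w :: "nat \<Rightarrow> real"
  assumes fin: "finite A" and tot: "sum d A = 0"
    and w: "mono_on A w"
    and cross: "\<And>i j. i \<in> A \<Longrightarrow> j \<in> A \<Longrightarrow> i < j \<Longrightarrow> d i > 0 \<Longrightarrow> d j \<ge> 0"
  shows "(\<Sum>i\<in>A. d i * w i) \<ge> 0"
proof (cases "\<exists>i\<in>A. d i > 0")
  case False
  then have "\<forall>i\<in>A. d i \<le> 0" by (auto simp: not_less)
  then have "\<forall>i\<in>A. d i = 0"
    using sum_nonneg_eq_0_iff[of A "\<lambda>i. - d i"] fin tot by (auto simp: sum_negf)
  then show ?thesis by simp
next
  case True
  define j where "j = (LEAST i. i \<in> A \<and> d i > 0)"
  have j: "j \<in> A" "d j > 0" using True LeastI_ex[of "\<lambda>i. i \<in> A \<and> d i > 0"] unfolding j_def by auto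
  have "d i * (w i - w j) \<ge> 0" if "i \<in> A" for i
  proof (cases "i < j")
    case True
    then have "d i \<le> 0" using not_less_Least[of i "\<lambda>i. i \<in> A \<and> d i > 0"] that unfolding j_def by force
    moreover have "w i \<le> w j" using mono_onD[OF w that j(1)] True by simp
    ultimately show ?thesis by (simp add: mult_nonpos_nonpos)
  next
    case False
    then have "d i \<ge> 0" using cross[OF j(1) that] j by (cases "i = j") auto
    moreover have "w j \<le> w i" using mono_onD[OF w j(1) that] False by simp
    ultimately show ?thesis by simp
  qed
  then have "(\<Sum>i\<in>A. d i * (w i - w j)) \<ge> 0" by (rule sum_nonneg)
  also have "(\<Sum>i\<in>A. d i * (w i - w j)) = (\<Sum>i\<in>A. d i * w i) - w j * sum d A"
    by (simp add: right_diff_distrib sum_subtractf sum_distrib_left mult.commute)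
  finally show ?thesis using tot by simp
qed

text \<open>The comparison is with the step distribution \<open>r\<close> of mass
  \<open>(1 - a) / n\<close>, \<open>1 / n\<close> and \<open>(1 + a) / n\<close> on the first
  \<open>m\<close>, the middle and the last \<open>m\<close> ranks. As \<open>q\<close> is sorted,
  \<open>q - r\<close> changes sign at most once, from negative to positive.\<close>

lemma rank_weighted_sum_ge:
  fixes q w :: "nat \<Rightarrow> real"
  assumes m: "1 \<le> m" "2 * m \<le> n" and tot: "sum q {1..n} = 1" and q: "mono_on {1..n} q"
    and low: "q m \<le> (1 - a) / n" and high: "q (n - m) \<ge> (1 + a) / n"
    and w: "mono_on {1..n} w"
  shows "(\<Sum>i=1..n. q i * w i) \<ge>
    (sum w {1..n} + a * (sum w {n-m<..n} - sum w {1..m})) / n"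
proof -
  define r :: "nat \<Rightarrow> real" where
    "r i = (1 + a * (of_bool (i > n - m) - of_bool (i \<le> m))) / n" for i
  have n: "n > 0" using m by linarith
  have ind: "(\<Sum>i=1..n. of_bool (i > n - m) * v i) = sum v {n-m<..n}"
       "(\<Sum>i=1..n. of_bool (i \<le> m) * v i) = sum v {1..m}" for v :: "nat \<Rightarrow> real"
  proof -
    have "{1..n} \<inter> {i. i > n - m} = {n-m<..n}" "{1..n} \<inter> {i. i \<le> m} = {1..m}" using m by auto
    then show "(\<Sum>i=1..n. of_bool (i > n - m) * v i) = sum v {n-m<..n}"
       "(\<Sum>i=1..n. of_bool (i \<le> m) * v i) = sum v {1..m}"
      using sum.inter_restrict[of "{1..n}" v "{i. i > n - m}"] sum.inter_restrict[of "{1..n}" v "{i. i \<le> m}"]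
      by (simp_all add: of_bool_def if_distrib[of "\<lambda>x. x * _"] cong: if_cong)
  qed
  have r: "(\<Sum>i=1..n. r i * v i) = (sum v {1..n} + a * (sum v {n-m<..n} - sum v {1..m})) / n" for v
  proof -
    have "(\<Sum>i=1..n. r i * v i)
        = (\<Sum>i=1..n. v i + a * (of_bool (i > n - m) * v i - of_bool (i \<le> m) * v i)) / n"
      unfolding sum_divide_distrib by (intro sum.cong) (simp_all add: r_def algebra_simps)
    then show ?thesis
      by (simp only: sum.distrib sum_subtractf sum_distrib_left[symmetric] ind)
  qed
  have "(\<Sum>i=1..n. (q i - r i) * w i) \<ge> 0"
  proof (rule sum_mult_single_crossing[OF _ _ w])
    have "sum r {1..n} = 1" using r[of "\<lambda>_. 1"] m n by (simp add: of_nat_diff)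
    then show "(\<Sum>i=1..n. q i - r i) = 0" using tot by (simp add: sum_subtractf)
    fix i j assume ij: "i \<in> {1..n}" "j \<in> {1..n}" "i < j" "q i - r i > 0"
    have rr: "r k = (if k \<le> m then (1 - a) / n else if k \<le> n - m then 1 / n else (1 + a) / n)" for k
      using m by (auto simp: r_def)
    \<comment> \<open>Up to rank \<open>m\<close>, \<open>q\<close> is at most \<open>q m\<close>,
      hence at most \<open>r\<close>, so no strict excess occurs there.\<close>
    have "\<not> i \<le> m"
      using mono_onD[OF q ij(1), of m] low ij m rr[of i] by force
    show "q j - r j \<ge> 0"
    proof (cases "j \<le> n - m")
      case True
      then show ?thesis using \<open>\<not> i \<le> m\<close> ij mono_onD[OF q ij(1,2)] by (simp add: rr)
    next
      case False
      moreover have "n - m \<in> {1..n}" using m by auto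
      ultimately show ?thesis
        using mono_onD[OF q _ ij(2), of "n-m"] high \<open>\<not> i \<le> m\<close> ij by (auto simp: rr)
    qed
  qed auto
  then show ?thesis using r[of w] by (simp add: left_diff_distrib sum_subtractf)
qed

text \<open>The first \<open>m\<close> entries carry at least a quarter of the sum of
  \<open>exp (a * y i)\<close>, and the last \<open>m\<close> at most \<open>m * X\<close>. If
  \<open>b < 0\<close>, then \<open>X \<le> 1\<close>. Otherwise the zero sum forces the last
  entries to average at most \<open>-2 * b\<close>, so their negative exponentials total at least
  \<open>m * X\<^sup>2\<close>, which absorbs \<open>m * X\<close> up to \<open>m\<close>.\<close>

lemma exp_spread_top:
  fixes y :: "nat \<Rightarrow> real"
  assumes m: "1 \<le> m" "3 * m \<le> n" "n \<le> 4 * m" and a: "a \<ge> 0"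
    and y: "antimono_on {1..n} y" and y0: "sum y {1..n} = 0"
  shows "(\<Sum>i=1..m. exp (a * y i)) - (\<Sum>i\<in>{n-m<..n}. exp (a * y i))
       + (\<Sum>i\<in>{n-m<..n}. exp (- a * y i)) - (\<Sum>i=1..m. exp (- a * y i))
     \<ge> (\<Sum>i=1..n. exp (a * y i)) / 4 - 2 * m"
proof -
  let ?T = "{1..m}" and ?B = "{n-m<..n}"
  define b where "b = y (n - m)"
  define X where "X = exp (a * b)"
  have yd: "y j \<le> y i" if "1 \<le> i" "i \<le> j" "j \<le> n" for i j
    using monotone_onD[OF y, of i j] that by simp
  have cB: "card ?B = m" using m by simp
  have split: "sum f {1..n} = sum f {1..n-m} + sum f ?B" for f :: "nat \<Rightarrow> real"
  proof -
    have "{1..n} = {1..n-m} \<union> ?B" using m by auto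
    then show ?thesis by (simp add: sum.union_disjoint ivl_disj_int)
  qed
  have "(\<Sum>i=1..n. exp (a * y i)) \<le> 4 * (\<Sum>i\<in>?T. exp (a * y i))"
  proof -
    have "{1..n} = ?T \<union> {m<..n}" using m by auto
    then have "(\<Sum>i=1..n. exp (a * y i)) = (\<Sum>i\<in>?T. exp (a * y i)) + (\<Sum>i\<in>{m<..n}. exp (a * y i))"
      by (simp add: sum.union_disjoint ivl_disj_int)
    also have "(\<Sum>i\<in>{m<..n}. exp (a * y i)) \<le> (\<Sum>i\<in>{m<..n}. exp (a * y m))"
      using m a yd by (intro sum_mono) (auto intro!: mult_left_mono)
    also have "\<dots> \<le> 3 * (\<Sum>i\<in>?T. exp (a * y m))" using m by (simp add: of_nat_diff)
    also have "(\<Sum>i\<in>?T. exp (a * y m)) \<le> (\<Sum>i\<in>?T. exp (a * y i))"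
      using m a yd by (intro sum_mono) (auto intro!: mult_left_mono)
    finally show ?thesis by simp
  qed
  moreover have "(\<Sum>i\<in>?B. exp (a * y i)) \<le> m * X"
  proof -
    have "(\<Sum>i\<in>?B. exp (a * y i)) \<le> (\<Sum>i\<in>?B. X)"
      unfolding X_def b_def using m a yd by (intro sum_mono) (auto intro!: mult_left_mono)
    then show ?thesis using cB by simp
  qed
  moreover have "(\<Sum>i\<in>?T. exp (- a * y i)) \<le> (\<Sum>i\<in>?B. exp (- a * y i))"
  proof -
    have "(\<Sum>i\<in>?T. exp (- a * y i)) \<le> (\<Sum>i\<in>?T. exp (- a * y m))"
      using m a yd by (intro sum_mono) (auto intro!: mult_left_mono)
    also have "\<dots> = (\<Sum>i\<in>?B. exp (- a * y m))" using cB by simp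
    also have "\<dots> \<le> (\<Sum>i\<in>?B. exp (- a * y i))"
      using m a yd by (intro sum_mono) (auto intro!: mult_left_mono)
    finally show ?thesis .
  qed
  moreover have "(\<Sum>i\<in>?B. exp (- a * y i)) - (\<Sum>i\<in>?T. exp (- a * y i)) \<ge> m * X\<^sup>2 - m" if b: "b \<ge> 0"
  proof -
    have T: "(\<Sum>i\<in>?T. exp (- a * y i)) \<le> (\<Sum>i\<in>?T. 1)"
      using m a b yd[of _ "n-m"] unfolding b_def
      by (intro sum_mono) (auto intro!: mult_nonneg_nonneg intro: order_trans)
    \<comment> \<open>At least \<open>2 * m\<close> entries are no smaller than \<open>b\<close>;
      since all entries sum to zero, the last \<open>m\<close> sum to at most
      \<open>-2 * m * b\<close>.\<close>
    have "(n - m) * b \<le> sum y {1..n-m}"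
      using sum_mono[of "{1..n-m}" "\<lambda>_. b" y] yd[of _ "n-m"] by (simp add: b_def)
    moreover have "2 * m * b \<le> (n - m) * b" using m b by (intro mult_right_mono) auto
    ultimately have sB: "- sum y ?B - 2 * m * b \<ge> 0" using y0 split[of y] by simp
    \<comment> \<open>Jensen by hand: the tangent of \<open>exp\<close> at \<open>2 * a * b\<close>,
      where its value is \<open>X\<^sup>2\<close>, is summed over the last \<open>m\<close>
      entries.\<close>
    have "m * X\<^sup>2 \<le> X\<^sup>2 * (m + a * (- sum y ?B - 2 * m * b))"
      using mult_nonneg_nonneg[OF zero_le_power2[of X] mult_nonneg_nonneg[OF a sB]]
      by (simp only: distrib_left mult.commute[of "real m"])
    also have "\<dots> = (\<Sum>i\<in>?B. X\<^sup>2 * (1 + (- a * y i - 2 * a * b)))"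
      using cB by (simp add: sum_distrib_left sum.distrib sum_subtractf sum_negf algebra_simps)
    also have "\<dots> \<le> (\<Sum>i\<in>?B. exp (- a * y i))"
    proof (rule sum_mono)
      fix i
      have "X\<^sup>2 * (1 + (- a * y i - 2 * a * b)) \<le> X\<^sup>2 * exp (- a * y i - 2 * a * b)"
        by (intro mult_left_mono) auto
      also have "\<dots> = exp (- a * y i)"
        by (simp add: X_def power2_eq_square exp_add[symmetric])
      finally show "X\<^sup>2 * (1 + (- a * y i - 2 * a * b)) \<le> exp (- a * y i)" .
    qed
    finally show ?thesis using T by simp
  qed
  moreover have "m * X \<le> m * X\<^sup>2 + m"
  proof -
    have "X \<le> X\<^sup>2 + 1" using zero_le_power2[of "X - 1/2"] by (simp add: power2_eq_square algebra_simps)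
    from mult_left_mono[OF this, of m] show ?thesis by (simp add: algebra_simps)
  qed
  moreover have "m * X \<le> m" if "b < 0"
  proof -
    have "X \<le> 1" using that a by (simp add: X_def mult_nonneg_nonpos)
    then show ?thesis by (simp add: mult_left_le)
  qed
  ultimately show ?thesis by (cases "b \<ge> 0") auto
qed

text \<open>Reversing and negating \<open>y\<close> gives another sorted vector with sum zero. This
  swaps the two exponential sums but leaves the spread unchanged, so averaging the two instances of
  \<open>exp_spread_top\<close> gives the claim, with \<open>2 * m \<le> n\<close>.\<close>

lemma exp_spread:
  fixes y :: "nat \<Rightarrow> real"
  assumes m: "1 \<le> m" "3 * m \<le> n" "n \<le> 4 * m" and a: "a \<ge> 0"
    and y: "antimono_on {1..n} y" and y0: "sum y {1..n} = 0"
  shows "(\<Sum>i=1..m. exp (a * y i)) - (\<Sum>i\<in>{n-m<..n}. exp (a * y i))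
       + (\<Sum>i\<in>{n-m<..n}. exp (- a * y i)) - (\<Sum>i=1..m. exp (- a * y i))
     \<ge> ((\<Sum>i=1..n. exp (a * y i)) + (\<Sum>i=1..n. exp (- a * y i))) / 8 - n"
proof -
  define z where "z i = - y (n + 1 - i)" for i
  have rev: "(\<Sum>i\<in>A. f (z i)) = (\<Sum>i\<in>(\<lambda>i. n + 1 - i) ` A. f (- y i))" if "A \<subseteq> {1..n}"
    for f :: "real \<Rightarrow> real" and A
  proof -
    have "inj_on (\<lambda>i. n + 1 - i) {1..n}" by (auto simp: inj_on_def)
    from inj_on_subset[OF this that] show ?thesis by (subst sum.reindex) (simp_all add: z_def)
  qed
  have im: "(\<lambda>i. n + 1 - i) ` {1..n} = {1..n}" "(\<lambda>i. n + 1 - i) ` {1..m} = {n-m<..n}"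
    "(\<lambda>i. n + 1 - i) ` {n-m<..n} = {1..m}"
  proof -
    have "(\<lambda>i. n + 1 - i) ` A = B"
      if "B \<subseteq> {1..n}" "\<And>i. i \<in> A \<Longrightarrow> n + 1 - i \<in> B" "\<And>i. i \<in> B \<Longrightarrow> n + 1 - i \<in> A" for A B
    proof (intro equalityI subsetI)
      fix i assume "i \<in> B"
      then show "i \<in> (\<lambda>i. n + 1 - i) ` A" using that by (intro image_eqI[of _ _ "n + 1 - i"]) force+
    qed (use that in auto)
    note image_reflect = this
    show "(\<lambda>i. n + 1 - i) ` {1..n} = {1..n}" by (rule image_reflect) auto
    show "(\<lambda>i. n + 1 - i) ` {1..m} = {n-m<..n}" by (rule image_reflect) (use m in auto)
    show "(\<lambda>i. n + 1 - i) ` {n-m<..n} = {1..m}" by (rule image_reflect) (use m in auto)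
  qed
  have z: "antimono_on {1..n} z"
  proof (rule monotone_onI)
    fix i j assume "i \<in> {1..n}" "j \<in> {1..n}" "i \<le> j"
    then show "z j \<le> z i" using monotone_onD[OF y, of "n + 1 - j" "n + 1 - i"] by (auto simp: z_def)
  qed
  have z0: "sum z {1..n} = 0" using rev[of "{1..n}" "\<lambda>x. x"] y0 im by (simp add: sum_negf)
  have sub: "{1..m} \<subseteq> {1..n}" "{n-m<..n} \<subseteq> {1..n}" using m by auto
  have "(\<Sum>i=1..m. exp (a * z i)) = (\<Sum>i\<in>{n-m<..n}. exp (- a * y i))"
       "(\<Sum>i=1..m. exp (- a * z i)) = (\<Sum>i\<in>{n-m<..n}. exp (a * y i))"
       "(\<Sum>i\<in>{n-m<..n}. exp (a * z i)) = (\<Sum>i=1..m. exp (- a * y i))"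
       "(\<Sum>i\<in>{n-m<..n}. exp (- a * z i)) = (\<Sum>i=1..m. exp (a * y i))"
       "(\<Sum>i=1..n. exp (a * z i)) = (\<Sum>i=1..n. exp (- a * y i))"
    using rev[OF sub(1), of "\<lambda>x. exp (a * x)"] rev[OF sub(1), of "\<lambda>x. exp (- a * x)"]
      rev[OF sub(2), of "\<lambda>x. exp (a * x)"] rev[OF sub(2), of "\<lambda>x. exp (- a * x)"]
      rev[of "{1..n}" "\<lambda>x. exp (a * x)"] im by simp_all
  then have "(\<Sum>i=1..n. exp (- a * y i)) / 4 - 2 * m
      \<le> (\<Sum>i=1..m. exp (a * y i)) - (\<Sum>i\<in>{n-m<..n}. exp (a * y i))
       + (\<Sum>i\<in>{n-m<..n}. exp (- a * y i)) - (\<Sum>i=1..m. exp (- a * y i))"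
    using exp_spread_top[OF m a z z0] by (simp add: algebra_simps)
  moreover have "(P + Q) / 8 - N \<le> T" if "Q / 4 - M \<le> T" "P / 4 - M \<le> T" "M \<le> N"
    for P Q M N T :: real using that by (simp add: field_simps)
  moreover have "real (2 * m) \<le> real n" using m by linarith
  ultimately show ?thesis using exp_spread_top[OF m a y y0] by blast
qed


section \<open>Exponential potentials of the load vector\<close>

definition dev :: "nat \<Rightarrow> nat list \<Rightarrow> nat \<Rightarrow> real" where
  "dev n h i = real (load h i) - real (length h) / real n"

definition exp_pot :: "nat \<Rightarrow> real \<Rightarrow> nat list \<Rightarrow> real" where
  "exp_pot n \<beta> h = (\<Sum>i=1..n. exp (\<beta> * dev n h i))"

text \<open>The hyperbolic cosine potential: twice the sum of
  \<open>cosh (\<alpha> * dev n h i)\<close>.\<close>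

definition cosh_pot :: "nat \<Rightarrow> real \<Rightarrow> nat list \<Rightarrow> real" where
  "cosh_pot n \<alpha> h = exp_pot n \<alpha> h + exp_pot n (-\<alpha>) h"

lemma sum_dev_eq_0:
  assumes "h \<in> lists {1..n}" "n > 0"
  shows "(\<Sum>i=1..n. dev n h i) = 0"
proof -
  have "(\<Sum>i=1..n. load h i) = length h"
    unfolding load_def using assms by (intro sum_count_set) auto
  then have "(\<Sum>i=1..n. real (load h i)) = real (length h)" by (metis of_nat_sum)
  then show ?thesis using assms by (simp add: dev_def sum_subtractf)
qed

text \<open>Every deviation drops by \<open>1 / n\<close> and only that of \<open>j\<close> gains 1.
  The new value is therefore affine in the exponential of the chosen bin, so its mean reduces to a
  rank-weighted sum.\<close>

lemma exp_pot_snoc: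
  assumes "j \<in> {1..n}"
  shows "exp_pot n \<beta> (h @ [j]) = exp (- \<beta> / n) * (exp_pot n \<beta> h + (exp \<beta> - 1) * exp (\<beta> * dev n h j))"
proof -
  have "exp (\<beta> * dev n (h @ [j]) i)
      = exp (- \<beta> / n) * (exp (\<beta> * dev n h i) + (if i = j then (exp \<beta> - 1) * exp (\<beta> * dev n h j) else 0))" for i
    by (auto simp: dev_def load_def exp_add[symmetric] field_simps add_divide_distrib)
  then show ?thesis
    using assms by (simp add: exp_pot_def sum_distrib_left[symmetric] sum.distrib)
qed

lemma exp_pot_permute:
  assumes "\<pi> permutes {1..n}"
  shows "(\<Sum>i=1..n. exp (\<beta> * dev n h (\<pi> i))) = exp_pot n \<beta> h"
  unfolding exp_pot_def by (subst (2) sum.permute[OF assms]) simp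

lemma exp_pot_nonneg [simp]: "exp_pot n \<beta> h \<ge> 0"
  unfolding exp_pot_def by (intro sum_nonneg) simp

lemma cosh_pot_nonneg [simp]: "cosh_pot n \<alpha> h \<ge> 0"
  by (simp add: cosh_pot_def)

section \<open>Scalar inequalities and bounds on a single step\<close>

lemma exp_le_quadratic:
  fixes x :: real
  assumes "\<bar>x\<bar> \<le> 1"
  shows "exp x \<le> 1 + x + x\<^sup>2"
proof (cases "x \<ge> 0")
  case True
  then show ?thesis using exp_bound[of x] assms by simp
next
  case False
  define t where "t = - x"
  have t: "t > 0" using False by (simp add: t_def)
  \<comment> \<open>The claimed bound times the quadratic Taylor minorant of \<open>exp t\<close> is
    at least 1; dividing by \<open>exp t\<close> settles negative \<open>x\<close>.\<close>
  have "1 \<le> 1 + (t\<^sup>2 + t ^ 3 + t ^ 4) / 2" using t by simp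
  also have "\<dots> = (1 - t + t\<^sup>2) * (1 + t + t\<^sup>2 / 2)"
    by (simp add: field_simps power2_eq_square power3_eq_cube power4_eq_xxxx)
  also have "\<dots> \<le> (1 - t + t\<^sup>2) * exp t"
  proof (rule mult_left_mono)
    show "0 \<le> 1 - t + t\<^sup>2" using zero_le_power2[of "t - 1/2"] by (simp add: power2_eq_square algebra_simps)
  qed (use t exp_lower_Taylor_quadratic[of t] in simp)
  finally have "exp (-t) \<le> 1 - t + t\<^sup>2"
    by (simp add: exp_minus field_simps)
  then show ?thesis by (simp add: t_def)
qed

text \<open>Merging both factors by \<open>1 + x \<le> exp x\<close> cancels the first order and
  leaves the exponent \<open>(g - \<alpha>) / N\<close>. It is applied with
  \<open>g = exp \<alpha> - 1\<close>, for \<open>\<alpha>\<close> of either sign.\<close>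

lemma growth_factor_le:
  fixes \<alpha> N g :: real
  assumes "\<bar>\<alpha>\<bar> \<le> 1 / 100" "N \<ge> 1" "g - \<alpha> \<le> \<alpha>\<^sup>2"
  shows "exp (- \<alpha> / N) * (1 + g / N) \<le> 1 + 2 * \<alpha>\<^sup>2 / N"
proof -
  have "exp (- \<alpha> / N) * (1 + g / N) \<le> exp (- \<alpha> / N) * exp (g / N)"
    by (intro mult_left_mono exp_ge_add_one_self) auto
  also have "\<dots> = exp ((g - \<alpha>) / N)" by (simp add: exp_add[symmetric] diff_divide_distrib)
  also have "\<dots> \<le> exp (\<alpha>\<^sup>2 / N)" using assms by (simp add: divide_right_mono)
  also have "\<dots> \<le> 1 + 2 * (\<alpha>\<^sup>2 / N)"
  proof (rule real_exp_bound_lemma)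
    have "\<alpha>\<^sup>2 / N \<le> \<alpha>\<^sup>2 / 1" using assms by (intro frac_le) auto
    also have "\<dots> \<le> (1/100)\<^sup>2 / 1"
      using power_mono[OF assms(1), of 2] by (intro divide_right_mono) auto
    finally show "\<alpha>\<^sup>2 / N \<le> 1 / 2" by (rule order_trans) (simp add: power2_eq_square)
  qed (use assms in auto)
  finally show ?thesis by simp
qed

text \<open>\<open>D\<close> stands for the excess weight of the heavy ranks. Without it,
  \<open>growth_factor_le\<close> leaves a second-order cost \<open>2 * \<alpha>\<^sup>2 / N\<close>
  per unit of \<open>P\<close>; the bias returns at least \<open>3/4 * \<alpha>\<close> times
  \<open>1/3 * D / N\<close>, whence \<open>D / 4\<close>.\<close>

lemma overloaded_drift:
  fixes \<alpha> N P D :: real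
  assumes "0 < \<alpha>" "\<alpha> \<le> 1 / 100" "N \<ge> 1" "P \<ge> 0" "D \<ge> 0"
  shows "exp (- \<alpha> / N) * (P + (exp \<alpha> - 1) * ((P - 1/3 * D) / N)) \<le> P + \<alpha> / N * (2 * \<alpha> * P - D / 4)"
proof -
  define g where "g = exp \<alpha> - 1"
  have g: "g \<ge> \<alpha>" "g - \<alpha> \<le> \<alpha>\<^sup>2"
    using exp_ge_add_one_self[of \<alpha>] exp_le_quadratic[of \<alpha>] assms unfolding g_def by linarith+
  have "exp (- \<alpha> / N) \<ge> 3/4"
  proof -
    have "\<alpha> / N \<le> (1/100) / 1" using assms by (intro frac_le) auto
    then show ?thesis using exp_ge_add_one_self[of "- \<alpha> / N"] by simp
  qed
  then have "3/4 * \<alpha> * (1/3 * D / N) \<le> exp (- \<alpha> / N) * g * (1/3 * D / N)"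
    using assms g by (intro mult_right_mono mult_mono) auto
  moreover have "exp (- \<alpha> / N) * (1 + g / N) * P \<le> (1 + 2 * \<alpha>\<^sup>2 / N) * P"
    using growth_factor_le[of \<alpha> N g] g(2) assms by (intro mult_right_mono) auto
  ultimately show ?thesis
    unfolding g_def[symmetric] using assms(3)
    by (simp add: algebra_simps power2_eq_square add_divide_distrib diff_divide_distrib)
qed

text \<open>The mirror image for the negative exponentials. Here the factor 3/4 comes from
  \<open>1 - exp (-\<alpha>)\<close> against \<open>\<alpha>\<close>, as
  \<open>exp (\<alpha> / N) \<ge> 1\<close>.\<close>

lemma underloaded_drift:
  fixes \<alpha> N P D :: real
  assumes "0 < \<alpha>" "\<alpha> \<le> 1 / 100" "N \<ge> 1" "P \<ge> 0" "D \<ge> 0"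
  shows "exp (\<alpha> / N) * (P + (exp (-\<alpha>) - 1) * ((P + 1/3 * D) / N)) \<le> P + \<alpha> / N * (2 * \<alpha> * P - D / 4)"
proof -
  define g where "g = 1 - exp (-\<alpha>)"
  have g: "g \<ge> \<alpha> - \<alpha>\<^sup>2" using exp_le_quadratic[of "-\<alpha>"] assms by (auto simp: g_def)
  have "\<alpha>\<^sup>2 \<le> \<alpha> * (1/100)" unfolding power2_eq_square using assms by (intro mult_left_mono) auto
  then have g34: "g \<ge> 3/4 * \<alpha>" using g assms(1) by linarith
  have "exp (\<alpha> / N) \<ge> 1" using assms by simp
  then have "1 * (3/4 * \<alpha>) * (1/3 * D / N) \<le> exp (\<alpha> / N) * g * (1/3 * D / N)"
    using assms g34 by (intro mult_right_mono mult_mono) auto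
  moreover have "exp (\<alpha> / N) * (1 - g / N) * P \<le> (1 + 2 * \<alpha>\<^sup>2 / N) * P"
    using growth_factor_le[of "-\<alpha>" N "-g"] g assms by (intro mult_right_mono) auto
  moreover have g': "exp (-\<alpha>) - 1 = - g" by (simp add: g_def)
  ultimately show ?thesis
    unfolding g' using assms(3)
    by (simp add: algebra_simps power2_eq_square add_divide_distrib diff_divide_distrib)
qed

lemma exp_mult_le_exp_abs:
  fixes \<alpha> d :: real
  assumes "\<alpha> \<ge> 0"
  shows "exp (\<alpha> * d) \<le> exp (\<alpha> * \<bar>d\<bar>)" "exp (-\<alpha> * d) \<le> exp (\<alpha> * \<bar>d\<bar>)"
  using mult_left_mono[OF abs_ge_self assms] mult_left_mono[OF abs_ge_minus_self assms] by simp_all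

lemma cosh_pot_le:
  assumes "\<And>i. i \<in> {1..n} \<Longrightarrow> exp (\<alpha> * \<bar>dev n h i\<bar>) \<le> M" and "\<alpha> \<ge> 0"
  shows "exp_pot n \<alpha> h \<le> n * M" "exp_pot n (-\<alpha>) h \<le> n * M"
proof -
  have "exp (\<alpha> * dev n h i) \<le> M" "exp (-\<alpha> * dev n h i) \<le> M" if "i \<in> {1..n}" for i
    using exp_mult_le_exp_abs[OF assms(2), of "dev n h i"] assms(1)[OF that] by linarith+
  then show "exp_pot n \<alpha> h \<le> n * M" "exp_pot n (-\<alpha>) h \<le> n * M"
    unfolding exp_pot_def
    using sum_bounded_above[of "{1..n}" "\<lambda>i. exp (\<alpha> * dev n h i)" M]
      sum_bounded_above[of "{1..n}" "\<lambda>i. exp (-\<alpha> * dev n h i)" M] by auto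
qed

text \<open>The common factors change \<open>P\<close> and \<open>Q\<close>, both at most
  \<open>n * M\<close>, by a relative amount of order \<open>\<alpha> / n\<close>, and the chosen
  bin changes terms of size at most \<open>M\<close> by a relative amount of order
  \<open>\<alpha>\<close>. Each of the four contributions is at most
  \<open>2 * \<alpha> * M\<close>, so the total stays below \<open>M\<close>.\<close>

lemma cosh_pot_increment_le:
  assumes M: "\<And>i. i \<in> {1..n} \<Longrightarrow> exp (\<alpha> * \<bar>dev n h i\<bar>) \<le> M"
    and a: "0 < \<alpha>" "\<alpha> \<le> 1 / 100" and j: "j \<in> {1..n}"
  shows "\<bar>cosh_pot n \<alpha> (h @ [j]) - cosh_pot n \<alpha> h\<bar> \<le> M"
proof -
  define x P Q U V where "x = \<alpha> / n" and "P = exp_pot n \<alpha> h" and "Q = exp_pot n (-\<alpha>) h"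
    and "U = exp (\<alpha> * dev n h j)" and "V = exp (-\<alpha> * dev n h j)"
  have n: "real n \<ge> 1" using j by auto
  have x: "0 < x" "x \<le> \<alpha>" "x * n = \<alpha>"
    using a n by (auto simp: x_def divide_le_eq mult_le_cancel_left1)
  have PQ: "0 \<le> P" "P \<le> n * M" "0 \<le> Q" "Q \<le> n * M"
    using cosh_pot_le[OF M] a by (auto simp: P_def Q_def)
  have UV: "0 \<le> U" "U \<le> M" "0 \<le> V" "V \<le> M"
    using exp_mult_le_exp_abs[OF less_imp_le[OF a(1)], of "dev n h j"] M[OF j]
    unfolding U_def V_def by (linarith | simp)+
  have ex: "1 - x \<le> exp (-x)" "exp (-x) \<le> 1" "1 \<le> exp x" "exp x \<le> 1 + 2 * x" "exp x \<le> 2"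
    "exp \<alpha> \<le> 1 + 2 * \<alpha>" "1 \<le> exp \<alpha>" "1 - \<alpha> \<le> exp (-\<alpha>)" "exp (-\<alpha>) \<le> 1"
    using exp_ge_add_one_self[of "-x"] exp_ge_add_one_self[of "-\<alpha>"]
      real_exp_bound_lemma[of x] real_exp_bound_lemma[of \<alpha>] x a by auto
  have xM: "x * P \<le> \<alpha> * M" "x * Q \<le> \<alpha> * M"
    using mult_left_mono[OF PQ(2), of x] mult_left_mono[OF PQ(4), of x] x
    by (auto simp flip: mult.assoc)
  have "cosh_pot n \<alpha> (h @ [j]) - cosh_pot n \<alpha> h
      = - ((1 - exp (-x)) * P) + exp (-x) * (exp \<alpha> - 1) * U + (exp x - 1) * Q - exp x * (1 - exp (-\<alpha>)) * V"
    by (simp add: cosh_pot_def exp_pot_snoc[OF j] P_def Q_def U_def V_def x_def algebra_simps)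
  moreover have "0 \<le> (1 - exp (-x)) * P" "(1 - exp (-x)) * P \<le> \<alpha> * M"
    using ex PQ xM mult_right_mono[of "1 - exp (-x)" x P] by auto
  moreover have "0 \<le> exp (-x) * (exp \<alpha> - 1) * U" "exp (-x) * (exp \<alpha> - 1) * U \<le> 1 * (2 * \<alpha>) * M"
    by (intro mult_nonneg_nonneg; use ex UV in force) (rule mult_mono[OF mult_mono]; use ex UV a in linarith)
  moreover have "0 \<le> (exp x - 1) * Q" "(exp x - 1) * Q \<le> 2 * (\<alpha> * M)"
    using ex PQ xM mult_right_mono[of "exp x - 1" "2 * x" Q] by auto
  moreover have "0 \<le> exp x * (1 - exp (-\<alpha>)) * V" "exp x * (1 - exp (-\<alpha>)) * V \<le> 2 * \<alpha> * M"
    by (intro mult_nonneg_nonneg; use ex UV in force) (rule mult_mono[OF mult_mono]; use ex UV a in linarith)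
  moreover have "\<alpha> * M \<le> 1/100 * M" using a UV by (intro mult_right_mono) auto
  ultimately show ?thesis using UV by linarith
qed

lemma exp_abs_dev_le_cosh_pot:
  assumes "i \<in> {1..n}"
  shows "exp (\<alpha> * \<bar>dev n h i\<bar>) \<le> cosh_pot n \<alpha> h"
proof -
  have "exp (\<beta> * dev n h i) \<le> exp_pot n \<beta> h" for \<beta>
    unfolding exp_pot_def using assms by (intro member_le_sum) auto
  from this[of \<alpha>] this[of "-\<alpha>"] show ?thesis
    by (cases "dev n h i \<ge> 0") (auto simp: cosh_pot_def intro: add_increasing add_increasing2)
qed

section \<open>Drift of the potential under a biased allocation\<close>

text \<open>The prefix \<open>take r h\<close> is the state after \<open>r\<close> balls, so an
  event about the whole trajectory becomes a predicate on one history.\<close>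

definition bounded_between :: "nat \<Rightarrow> real \<Rightarrow> real \<Rightarrow> nat \<Rightarrow> nat \<Rightarrow> nat list \<Rightarrow> bool" where
  "bounded_between n \<alpha> M a b h \<longleftrightarrow> (\<forall>r\<in>{a..b}. \<forall>i\<in>{1..n}. exp (\<alpha> * \<bar>dev n (take r h) i\<bar>) \<le> M)"

text \<open>Here \<open>m\<close> stands for a third of \<open>n\<close>, rounded down, and
  \<open>1/3\<close> is the value of \<open>4 * \<epsilon>\<close>. The bound
  \<open>n \<le> 4 * m\<close> absorbs the rounding and holds for all
  \<open>n \<ge> 9\<close>.\<close>

locale biased_allocation =
  fixes n m :: nat and p :: "nat pmf" and \<tau> :: "nat list \<Rightarrow> (nat \<Rightarrow> nat) pmf"
  assumes m: "1 \<le> m" "3 * m \<le> n" "n \<le> 4 * m"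
    and supp: "set_pmf p \<subseteq> {1..n}" and mono: "mono_on {1..n} (pmf p)"
    and low: "pmf p m \<le> (1 - 1/3) / n" and high: "pmf p (n - m) \<ge> (1 + 1/3) / n"
    and ties: "tie_breaking_rule n \<tau>"
begin

lemma n_pos: "n > 0" "real n \<ge> 1"
  using m by auto

lemma sum_pmf_rank: "(\<Sum>i=1..n. pmf p i) = 1" "(\<Sum>i=Suc 0..n. pmf p i) = 1"
  using supp by (auto intro!: sum_pmf_eq_1)

lemma expected_exp_pot:
  assumes "\<pi> permutes {1..n}"
  shows "(\<Sum>i=1..n. pmf p i * exp_pot n \<beta> (h @ [\<pi> i]))
    = exp (- \<beta> / n) * (exp_pot n \<beta> h + (exp \<beta> - 1) * (\<Sum>i=1..n. pmf p i * exp (\<beta> * dev n h (\<pi> i))))"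
proof -
  have "(\<Sum>i=1..n. pmf p i * exp_pot n \<beta> (h @ [\<pi> i])) = (\<Sum>i=1..n. exp (- \<beta> / n) *
    (pmf p i * exp_pot n \<beta> h + (exp \<beta> - 1) * (pmf p i * exp (\<beta> * dev n h (\<pi> i)))))"
  proof (rule sum.cong)
    fix i assume "i \<in> {1..n}"
    then have "\<pi> i \<in> {1..n}" using permutes_in_image[OF assms] by blast
    then show "pmf p i * exp_pot n \<beta> (h @ [\<pi> i]) = exp (- \<beta> / n) *
      (pmf p i * exp_pot n \<beta> h + (exp \<beta> - 1) * (pmf p i * exp (\<beta> * dev n h (\<pi> i))))"
      by (subst exp_pot_snoc) (simp_all add: algebra_simps)
  qed simp
  also have "\<dots> = exp (- \<beta> / n) * ((\<Sum>i=1..n. pmf p i) * exp_pot n \<beta> h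
      + (exp \<beta> - 1) * (\<Sum>i=1..n. pmf p i * exp (\<beta> * dev n h (\<pi> i))))"
    by (simp only: sum_distrib_left[symmetric] sum_distrib_right[symmetric] sum.distrib)
  finally show ?thesis by (simp add: sum_pmf_rank)
qed

text \<open>Through \<open>\<pi>\<close> the bins become ranks with sorted deviations.
  \<open>rank_weighted_sum_ge\<close> converts the bias of \<open>p\<close> into gains proportional
  to \<open>D\<close> and \<open>E\<close>, and \<open>exp_spread\<close> shows that
  \<open>D + E\<close> is a constant fraction of the potential, up to \<open>n\<close>.\<close>

lemma cosh_pot_drift:
  assumes h: "h \<in> lists {1..n}" and \<pi>: "\<pi> \<in> load_orders n (load h)"
    and a: "0 < \<alpha>" "\<alpha> \<le> 1 / 100"
  shows "(\<Sum>i=1..n. pmf p i * cosh_pot n \<alpha> (h @ [\<pi> i])) \<le> (1 - \<alpha> / (100 * n)) * cosh_pot n \<alpha> h + \<alpha>"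
proof -
  define y where "y i = dev n h (\<pi> i)" for i
  have perm: "\<pi> permutes {1..n}" using \<pi> by (simp add: load_orders_def)
  have y: "antimono_on {1..n} y"
    using \<pi> by (auto simp: load_orders_def monotone_on_def y_def dev_def)
  have y0: "sum y {1..n} = 0"
    using sum_dev_eq_0[OF h n_pos(1)] sum.permute[OF perm, of "dev n h"] by (simp add: y_def o_def)
  define P Q where "P = exp_pot n \<alpha> h" and "Q = exp_pot n (-\<alpha>) h"
  have P: "P = (\<Sum>i=1..n. exp (\<alpha> * y i))" and Q: "Q = (\<Sum>i=1..n. exp (-\<alpha> * y i))"
    using exp_pot_permute[OF perm, of \<alpha> h] exp_pot_permute[OF perm, of "-\<alpha>" h]
    by (simp_all add: P_def Q_def y_def)
  have PQ: "P \<ge> 0" "Q \<ge> 0" by (auto simp: P_def Q_def)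
  define D E where "D = (\<Sum>i=1..m. exp (\<alpha> * y i)) - (\<Sum>i\<in>{n-m<..n}. exp (\<alpha> * y i))"
    and "E = (\<Sum>i\<in>{n-m<..n}. exp (-\<alpha> * y i)) - (\<Sum>i=1..m. exp (-\<alpha> * y i))"
  have wm: "mono_on {1..n} (\<lambda>i. - exp (\<alpha> * y i))" "mono_on {1..n} (\<lambda>i. exp (-\<alpha> * y i))"
    using y a by (auto simp: monotone_on_def)
  have DE: "D + E \<ge> (P + Q) / 8 - n"
    using exp_spread[OF m, of \<alpha> y] a y y0 unfolding P Q D_def E_def by simp
  have top_le: "(\<Sum>i\<in>{n-m<..n}. f (y i)) \<le> (\<Sum>i=1..m. f (y i))" if "mono f" for f :: "real \<Rightarrow> real"
  proof -
    have "(\<Sum>i\<in>{n-m<..n}. f (y i)) \<le> (\<Sum>i\<in>{n-m<..n}. f (y m))"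
      using m monotone_onD[OF y, of m] by (intro sum_mono monoD[OF that]) auto
    also have "\<dots> = (\<Sum>i=1..m. f (y m))" using m by simp
    also have "\<dots> \<le> (\<Sum>i=1..m. f (y i))"
      using m monotone_onD[OF y, of _ m] by (intro sum_mono monoD[OF that]) auto
    finally show ?thesis .
  qed
  have D: "D \<ge> 0" using top_le[of "\<lambda>x. exp (\<alpha> * x)"] a by (simp add: D_def mono_def)
  have E: "E \<ge> 0" using top_le[of "\<lambda>x. - exp (-\<alpha> * x)"] a by (simp add: E_def mono_def sum_negf)
  have m2: "2 * m \<le> n" using m by simp
  \<comment> \<open>Rank 1 is the fullest bin, so \<open>exp (\<alpha> * y i)\<close> decreases in
    the rank; the comparison is applied to its negative and yields an upper bound.\<close>
  have up: "(\<Sum>i=1..n. pmf p i * exp (\<alpha> * y i)) \<le> (P - 1/3 * D) / n"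
    using rank_weighted_sum_ge[OF m(1) m2 sum_pmf_rank(1) mono low high wm(1)]
    by (simp add: P D_def sum_negf algebra_simps diff_divide_distrib add_divide_distrib)
  have down: "(\<Sum>i=1..n. pmf p i * exp (-\<alpha> * y i)) \<ge> (Q + 1/3 * E) / n"
    using rank_weighted_sum_ge[OF m(1) m2 sum_pmf_rank(1) mono low high wm(2)]
    by (simp add: Q E_def)
  have "(\<Sum>i=1..n. pmf p i * exp_pot n \<alpha> (h @ [\<pi> i])) \<le> exp (- \<alpha> / n) * (P + (exp \<alpha> - 1) * ((P - 1/3 * D) / n))"
    unfolding expected_exp_pot[OF perm] P_def[symmetric]
    using up a by (intro mult_left_mono add_left_mono) (auto simp: y_def)
  also have "\<dots> \<le> P + \<alpha> / n * (2 * \<alpha> * P - D / 4)"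
    using overloaded_drift[OF a n_pos(2) PQ(1) D] .
  finally have 1: "(\<Sum>i=1..n. pmf p i * exp_pot n \<alpha> (h @ [\<pi> i])) \<le> P + \<alpha> / n * (2 * \<alpha> * P - D / 4)" .
  have "(\<Sum>i=1..n. pmf p i * exp_pot n (-\<alpha>) (h @ [\<pi> i])) \<le> exp (\<alpha> / n) * (Q + (exp (-\<alpha>) - 1) * ((Q + 1/3 * E) / n))"
    unfolding expected_exp_pot[OF perm] Q_def[symmetric] minus_minus
    using down a by (intro mult_left_mono add_left_mono mult_left_mono_neg) (auto simp: y_def)
  also have "\<dots> \<le> Q + \<alpha> / n * (2 * \<alpha> * Q - E / 4)"
    using underloaded_drift[OF a n_pos(2) PQ(2) E] .
  finally have 2: "(\<Sum>i=1..n. pmf p i * exp_pot n (-\<alpha>) (h @ [\<pi> i])) \<le> Q + \<alpha> / n * (2 * \<alpha> * Q - E / 4)" .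
  \<comment> \<open>The second-order loss is at most \<open>(P + Q) / 50\<close>, the gain at least
    \<open>(P + Q) / 32 - n / 4\<close>; the difference 1/32 - 1/50 exceeds 1/100.\<close>
  have "\<alpha> * (P + Q) \<le> 1/100 * (P + Q)" using a PQ by (intro mult_right_mono) auto
  then have 3: "2 * \<alpha> * (P + Q) - (D + E) / 4 \<le> n - (P + Q) / 100"
    using DE PQ n_pos(2) by (simp add: field_simps)
  have "(\<Sum>i=1..n. pmf p i * cosh_pot n \<alpha> (h @ [\<pi> i])) \<le> (P + Q) + \<alpha> / n * (2 * \<alpha> * (P + Q) - (D + E) / 4)"
    using add_mono[OF 1 2]
    by (simp add: cosh_pot_def distrib_left sum.distrib algebra_simps diff_divide_distrib add_divide_distrib)
  also have "\<dots> \<le> (P + Q) + \<alpha> / n * (n - (P + Q) / 100)"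
    using 3 a n_pos by (intro add_left_mono mult_left_mono) auto
  also have "\<dots> = (1 - \<alpha> / (100 * n)) * cosh_pot n \<alpha> h + \<alpha>"
    using n_pos by (simp add: cosh_pot_def P_def Q_def field_simps)
  finally show ?thesis .
qed

text \<open>The choice of \<open>\<theta>\<close> makes the quadratic term
  \<open>(\<theta> * M)\<^sup>2\<close> equal to \<open>\<theta> * \<alpha> / 2\<close>, half of the
  first-order decrease available when the potential is at least \<open>200 * n\<close>. Below that
  level a crude bound on the new value suffices.\<close>

lemma exp_cosh_pot_step:
  assumes h: "h \<in> lists {1..n}" and \<pi>: "\<pi> \<in> load_orders n (load h)"
    and a: "0 < \<alpha>" "\<alpha> \<le> 1 / 100"
    and M: "\<And>i. i \<in> {1..n} \<Longrightarrow> exp (\<alpha> * \<bar>dev n h i\<bar>) \<le> M"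
    and \<theta>: "\<theta> = \<alpha> / (2 * M\<^sup>2)"
  shows "(\<Sum>i=1..n. pmf p i * exp (\<theta> * cosh_pot n \<alpha> (h @ [\<pi> i])))
    \<le> (1 - \<theta> * \<alpha> / 2) * exp (\<theta> * cosh_pot n \<alpha> h) + exp (200 * \<theta> * n + 1)"
proof -
  define G where "G = cosh_pot n \<alpha> h"
  define d where "d i = cosh_pot n \<alpha> (h @ [\<pi> i]) - G" for i
  have perm: "\<pi> permutes {1..n}" using \<pi> by (simp add: load_orders_def)
  have "1 \<le> exp (\<alpha> * \<bar>dev n h 1\<bar>)" using a by simp
  also have "\<dots> \<le> M" using M n_pos by simp
  finally have M1: "M \<ge> 1" .
  then have M2: "M \<le> M\<^sup>2" "1 \<le> M\<^sup>2" by (auto intro: self_le_power)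
  have th: "\<theta> > 0" using a M1 by (simp add: \<theta>)
  have thM: "\<theta> * M \<le> 1" "\<theta> * M\<^sup>2 = \<alpha> / 2" "\<theta> \<le> 1"
    using a M1 M2 mult_mono[of M "M\<^sup>2" \<alpha> 2] by (auto simp: \<theta> field_simps)
  have d: "\<bar>d i\<bar> \<le> M" if "i \<in> {1..n}" for i
    unfolding d_def G_def using cosh_pot_increment_le[OF M a] permutes_in_image[OF perm] that by blast
  have thd: "\<bar>\<theta> * d i\<bar> \<le> \<theta> * M" if "i \<in> {1..n}" for i
    using d[OF that] th by (simp add: abs_mult)
  have "\<theta> * \<alpha> \<le> 1 * 1" using th thM a by (intro mult_mono) auto
  then have nn: "(1 - \<theta> * \<alpha> / 2) * exp (\<theta> * G) \<ge> 0" by simp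
  show ?thesis
  proof (cases "G \<ge> 200 * n")
    case True
    have "(\<Sum>i=1..n. pmf p i * exp (\<theta> * (G + d i)))
        \<le> (\<Sum>i=1..n. pmf p i * (exp (\<theta> * G) * (1 + \<theta> * d i + \<theta> * (\<alpha> / 2))))"
    proof (intro sum_mono mult_left_mono)
      fix i assume i: "i \<in> {1..n}"
      have "exp (\<theta> * d i) \<le> 1 + \<theta> * d i + (\<theta> * d i)\<^sup>2"
        using thd[OF i] thM by (intro exp_le_quadratic) simp
      also have "(\<theta> * d i)\<^sup>2 \<le> (\<theta> * M)\<^sup>2" using power_mono[OF thd[OF i], of 2] by simp
      also have "\<dots> = \<theta> * (\<alpha> / 2)" unfolding thM(2)[symmetric] by (simp add: power2_eq_square)
      finally have "exp (\<theta> * d i) \<le> 1 + \<theta> * d i + \<theta> * (\<alpha> / 2)" by simp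
      then have "exp (\<theta> * G) * exp (\<theta> * d i) \<le> exp (\<theta> * G) * (1 + \<theta> * d i + \<theta> * (\<alpha> / 2))"
        by (rule mult_left_mono) simp
      then show "exp (\<theta> * (G + d i)) \<le> exp (\<theta> * G) * (1 + \<theta> * d i + \<theta> * (\<alpha> / 2))"
        by (simp only: distrib_left[of \<theta>] exp_add)
    qed auto
    also have "\<dots> = exp (\<theta> * G) * ((\<Sum>i=1..n. pmf p i) * (1 + \<theta> * (\<alpha> / 2)) + \<theta> * (\<Sum>i=1..n. pmf p i * d i))"
      unfolding sum_distrib_left sum_distrib_right sum.distrib[symmetric] by (intro sum.cong) (auto simp: algebra_simps)
    also have "\<dots> \<le> exp (\<theta> * G) * (1 + \<theta> * (\<alpha> / 2) + \<theta> * (-\<alpha>))"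
    proof -
      have "(\<Sum>i=1..n. pmf p i * d i) = (\<Sum>i=1..n. pmf p i * cosh_pot n \<alpha> (h @ [\<pi> i])) - (\<Sum>i=1..n. pmf p i) * G"
        by (simp add: d_def right_diff_distrib sum_subtractf sum_distrib_right)
      also have "\<dots> \<le> \<alpha> - \<alpha> * (G / (100 * n))"
        using cosh_pot_drift[OF h \<pi> a] by (simp add: sum_pmf_rank G_def left_diff_distrib)
      \<comment> \<open>This is where the threshold \<open>200 * n\<close> enters: the contraction
        then outweighs the additive \<open>\<alpha>\<close> twice.\<close>
      also have "\<dots> \<le> \<alpha> - \<alpha> * 2"
        using True n_pos a by (intro diff_left_mono mult_left_mono) (auto simp: field_simps)
      finally have "(\<Sum>i=1..n. pmf p i * d i) \<le> -\<alpha>" by simp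
      then show ?thesis using th by (intro mult_left_mono add_mono) (auto simp: sum_pmf_rank)
    qed
    also have "\<dots> = (1 - \<theta> * \<alpha> / 2) * exp (\<theta> * G)" by (simp add: algebra_simps)
    finally show ?thesis by (simp add: d_def G_def add_increasing2)
  next
    case False
    have "(\<Sum>i=1..n. pmf p i * exp (\<theta> * (G + d i))) \<le> (\<Sum>i=1..n. pmf p i * exp (200 * \<theta> * n + 1))"
    proof (intro sum_mono mult_left_mono)
      fix i assume i: "i \<in> {1..n}"
      have "\<theta> * G \<le> \<theta> * (200 * n)" using False th by (intro mult_left_mono) auto
      \<comment> \<open>One ball moves the exponent by at most \<open>\<theta> * M \<le> 1\<close>,
        hence the \<open>+ 1\<close>.\<close>
      then show "exp (\<theta> * (G + d i)) \<le> exp (200 * \<theta> * n + 1)"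
        using thd[OF i] thM by (simp add: algebra_simps)
    qed auto
    also have "\<dots> = exp (200 * \<theta> * n + 1)"
      unfolding sum_distrib_right[symmetric] by (simp add: sum_pmf_rank)
    finally show ?thesis using nn by (simp add: d_def G_def)
  qed
qed

section \<open>From one-step sums to expectations over the process\<close>

lemma set_pmf_allocation: "set_pmf (allocation \<tau> p s) \<subseteq> {h \<in> lists {1..n}. length h = s}"
proof (induction s)
  case (Suc s)
  show ?case
  proof
    fix h' assume "h' \<in> set_pmf (allocation \<tau> p (Suc s))"
    then obtain h \<pi> i where h: "h \<in> set_pmf (allocation \<tau> p s)" "\<pi> \<in> set_pmf (\<tau> h)"
      "i \<in> set_pmf p" "h' = h @ [\<pi> i]" by auto
    then have h_in: "h \<in> lists {1..n}" "length h = s" using Suc by auto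
    then have "\<pi> permutes {1..n}" using ties h by (auto simp: tie_breaking_rule_def load_orders_def)
    then have "\<pi> i \<in> {1..n}" using permutes_in_image[of \<pi> "{1..n}" i] h supp by blast
    then show "h' \<in> {h \<in> lists {1..n}. length h = Suc s}" using h h_in by simp
  qed
qed simp

lemma finite_set_pmf_allocation: "finite (set_pmf (allocation \<tau> p s))"
proof (rule finite_subset[OF set_pmf_allocation])
  have "{h \<in> lists {1..n}. length h = s} = {h. set h \<subseteq> {1..n} \<and> length h = s}" by auto
  then show "finite {h \<in> lists {1..n}. length h = s}" by (simp add: finite_lists_length_eq)
qed

lemma integrable_allocation: "integrable (measure_pmf (allocation \<tau> p s)) (f :: _ \<Rightarrow> real)"
  by (rule integrable_measure_pmf_finite[OF finite_set_pmf_allocation])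

text \<open>The hypothesis covers every admissible order, so it survives averaging over whatever
  order \<open>\<tau>\<close> draws, however that depends on the history. All supports are finite,
  and conditioning amounts to finite sums.\<close>

lemma expectation_Suc_le:
  fixes f g :: "nat list \<Rightarrow> real"
  assumes "\<And>h \<pi>. h \<in> lists {1..n} \<Longrightarrow> length h = s \<Longrightarrow> \<pi> \<in> load_orders n (load h) \<Longrightarrow>
    (\<Sum>i=1..n. pmf p i * f (h @ [\<pi> i])) \<le> g h"
  shows "measure_pmf.expectation (allocation \<tau> p (Suc s)) f \<le> measure_pmf.expectation (allocation \<tau> p s) g"
proof -
  let ?A = "set_pmf (allocation \<tau> p s)"
  let ?K = "\<lambda>h \<pi>. p \<bind> (\<lambda>i. return_pmf (h @ [\<pi> i]))"
  have fp: "finite (set_pmf p)" using supp finite_subset by blast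
  have h: "h \<in> lists {1..n}" "length h = s" if "h \<in> ?A" for h using set_pmf_allocation that by auto
  have ord: "set_pmf (\<tau> h) \<subseteq> load_orders n (load h)" if "h \<in> ?A" for h
    using ties h[OF that] by (simp add: tie_breaking_rule_def)
  have fin: "finite (set_pmf (\<tau> h))" if "h \<in> ?A" for h
    using finite_subset[OF ord[OF that]] finite_subset[OF _ finite_permutations[of "{1..n}"]]
    by (auto simp: load_orders_def)
  have K: "measure_pmf.expectation (?K h \<pi>) f = (\<Sum>i=1..n. pmf p i * f (h @ [\<pi> i]))" for h \<pi>
    using pmf_expectation_bind[of "{1..n}" "\<lambda>i. return_pmf (h @ [\<pi> i])" p f] supp by simp
  have "measure_pmf.expectation (\<tau> h \<bind> ?K h) f \<le> g h" if hA: "h \<in> ?A" for h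
  proof -
    have "measure_pmf.expectation (\<tau> h \<bind> ?K h) f
        = (\<Sum>\<pi>\<in>set_pmf (\<tau> h). pmf (\<tau> h) \<pi> * (\<Sum>i=1..n. pmf p i * f (h @ [\<pi> i])))"
      using pmf_expectation_bind[of "set_pmf (\<tau> h)" "?K h" "\<tau> h" f] fin[OF hA] fp by (simp add: K)
    also have "\<dots> \<le> (\<Sum>\<pi>\<in>set_pmf (\<tau> h). pmf (\<tau> h) \<pi> * g h)"
      using assms h[OF hA] ord[OF hA] by (intro sum_mono mult_left_mono) auto
    also have "\<dots> = g h"
      unfolding sum_distrib_right[symmetric] using fin[OF hA] by (simp add: sum_pmf_eq_1)
    finally show ?thesis .
  qed
  then have "(\<Sum>h\<in>?A. pmf (allocation \<tau> p s) h * measure_pmf.expectation (\<tau> h \<bind> ?K h) f)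
      \<le> (\<Sum>h\<in>?A. pmf (allocation \<tau> p s) h * g h)"
    by (intro sum_mono mult_left_mono) auto
  moreover have "measure_pmf.expectation (allocation \<tau> p (Suc s)) f
      = (\<Sum>h\<in>?A. pmf (allocation \<tau> p s) h * measure_pmf.expectation (\<tau> h \<bind> ?K h) f)"
    using pmf_expectation_bind[of ?A "\<lambda>h. \<tau> h \<bind> ?K h" "allocation \<tau> p s" f]
      finite_set_pmf_allocation fin fp by simp
  moreover have "measure_pmf.expectation (allocation \<tau> p s) g = (\<Sum>h\<in>?A. pmf (allocation \<tau> p s) h * g h)"
    using integral_measure_pmf_real[OF finite_set_pmf_allocation, of "allocation \<tau> p s" g]
    by (simp add: mult.commute)
  ultimately show ?thesis by simp
qed

text \<open>The value \<open>100 * n\<close> is the fixed point of the recursion given by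
  \<open>cosh_pot_drift\<close>, and the empty history starts below it, at
  \<open>2 * n\<close>.\<close>

lemma expectation_cosh_pot_le:
  assumes a: "0 < \<alpha>" "\<alpha> \<le> 1 / 100"
  shows "measure_pmf.expectation (allocation \<tau> p s) (cosh_pot n \<alpha>) \<le> 100 * n"
proof (induction s)
  case 0
  then show ?case by (simp add: cosh_pot_def exp_pot_def dev_def load_def)
next
  case (Suc s)
  let ?E = "measure_pmf.expectation (allocation \<tau> p s)"
  have "measure_pmf.expectation (allocation \<tau> p (Suc s)) (cosh_pot n \<alpha>)
      \<le> ?E (\<lambda>h. (1 - \<alpha> / (100 * n)) * cosh_pot n \<alpha> h + \<alpha>)"
    using cosh_pot_drift a by (intro expectation_Suc_le) auto
  also have "\<dots> = (1 - \<alpha> / (100 * n)) * ?E (cosh_pot n \<alpha>) + \<alpha>"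
    using integrable_allocation by simp
  also have "\<dots> \<le> (1 - \<alpha> / (100 * n)) * (100 * n) + \<alpha>"
  proof -
    have "\<alpha> / (100 * n) \<le> 1 / 1" using a n_pos by (intro frac_le) auto
    then show ?thesis using Suc by (intro add_right_mono mult_left_mono) auto
  qed
  also have "\<dots> = 100 * n" using n_pos by (simp add: field_simps)
  finally show ?case .
qed

section \<open>Concentration\<close>

text \<open>Balls are only appended, so prefixes of a long run have the law of shorter runs. This
  places all times on one probability space.\<close>

lemma map_take_allocation:
  "r \<le> s \<Longrightarrow> map_pmf (take r) (allocation \<tau> p s) = allocation \<tau> p r"
proof (induction s)
  case (Suc s)
  show ?case
  proof (cases "r = Suc s")
    case True
    have "map_pmf (take r) (allocation \<tau> p (Suc s)) = map_pmf (\<lambda>h. h) (allocation \<tau> p (Suc s))"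
    proof (rule map_pmf_cong[OF refl])
      fix h assume "h \<in> set_pmf (allocation \<tau> p (Suc s))"
      then have "length h = Suc s" using set_pmf_allocation[of "Suc s"] by blast
      then show "take r h = h" using True by simp
    qed
    then show ?thesis using True by simp
  next
    case False
    then have r: "r \<le> s" using Suc by simp
    have "map_pmf (take r) (allocation \<tau> p (Suc s))
        = allocation \<tau> p s \<bind> (\<lambda>h. \<tau> h \<bind> (\<lambda>\<pi>. p \<bind> (\<lambda>i. return_pmf (take r (h @ [\<pi> i])))))"
      by (simp add: map_bind_pmf)
    also have "\<dots> = allocation \<tau> p s \<bind> (\<lambda>h. return_pmf (take r h))"
      using set_pmf_allocation[of s] r by (intro bind_pmf_cong) auto
    also have "\<dots> = map_pmf (take r) (allocation \<tau> p s)" by (simp add: map_pmf_def)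
    finally show ?thesis using Suc.IH r by simp
  qed
qed simp

lemma prob_take:
  assumes "r \<le> s"
  shows "measure_pmf.prob (allocation \<tau> p s) {h. P (take r h)} = measure_pmf.prob (allocation \<tau> p r) {h. P h}"
  unfolding map_take_allocation[OF assms, symmetric] by (simp add: vimage_def)

lemma expectation_mono:
  fixes f g :: "nat list \<Rightarrow> real"
  assumes "\<And>h. h \<in> lists {1..n} \<Longrightarrow> length h = s \<Longrightarrow> f h \<le> g h"
  shows "measure_pmf.expectation (allocation \<tau> p s) f \<le> measure_pmf.expectation (allocation \<tau> p s) g"
  using set_pmf_allocation[of s] assms
  by (intro integral_mono_AE integrable_allocation) (auto simp: AE_measure_pmf_iff)

text \<open>The indicator discards a trajectory as soon as some term exceeds \<open>M\<close>; on
  the surviving ones \<open>exp_cosh_pot_step\<close> applies. The result is a linear recursion with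
  contraction \<open>1 - \<theta> * \<alpha> / 2\<close>, whose fixed point is the last
  summand.\<close>

lemma truncated_exp_moment_le:
  fixes \<alpha> M \<theta> :: real
  assumes a: "0 < \<alpha>" "\<alpha> \<le> 1 / 100" and M: "M \<ge> 1" and \<theta>: "\<theta> = \<alpha> / (2 * M\<^sup>2)"
    and W: "\<And>h. h \<in> lists {1..n} \<Longrightarrow> length h = t0 \<Longrightarrow> bounded_between n \<alpha> M t0 t0 h \<Longrightarrow>
      exp (\<theta> * cosh_pot n \<alpha> h) \<le> W" and "W \<ge> 0"
    and s: "t0 \<le> s"
  shows "measure_pmf.expectation (allocation \<tau> p s)
      (\<lambda>h. of_bool (bounded_between n \<alpha> M t0 s h) * exp (\<theta> * cosh_pot n \<alpha> h))
    \<le> (1 - \<theta> * \<alpha> / 2) ^ (s - t0) * W + 2 / (\<theta> * \<alpha>) * exp (200 * \<theta> * n + 1)"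
  using s
proof (induction s rule: dec_induct)
  case base
  have th: "\<theta> \<ge> 0" using a M by (simp add: \<theta>)
  have "measure_pmf.expectation (allocation \<tau> p t0)
      (\<lambda>h. of_bool (bounded_between n \<alpha> M t0 t0 h) * exp (\<theta> * cosh_pot n \<alpha> h))
    \<le> measure_pmf.expectation (allocation \<tau> p t0) (\<lambda>_. W)"
    using W \<open>W \<ge> 0\<close> by (intro expectation_mono) (auto simp: of_bool_def)
  moreover have "2 / (\<theta> * \<alpha>) * exp (200 * \<theta> * n + 1) \<ge> 0" using a th by simp
  ultimately show ?case by simp
next
  case (step s)
  let ?f = "\<lambda>s h. of_bool (bounded_between n \<alpha> M t0 s h) * exp (\<theta> * cosh_pot n \<alpha> h)"
  let ?B = "exp (200 * \<theta> * n + 1)" and ?r = "1 - \<theta> * \<alpha> / 2"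
  have th: "\<theta> > 0" using a M by (simp add: \<theta>)
  have "\<theta> \<le> \<alpha> / (2 * 1)" unfolding \<theta> using a M by (intro divide_left_mono mult_left_mono) auto
  then have "\<theta> * \<alpha> \<le> 1 * 1" using th a by (intro mult_mono) auto
  then have r: "?r \<ge> 0" by simp
  have "measure_pmf.expectation (allocation \<tau> p (Suc s)) (?f (Suc s))
      \<le> measure_pmf.expectation (allocation \<tau> p s) (\<lambda>h. ?r * ?f s h + ?B)"
  proof (rule expectation_Suc_le)
    fix h \<pi> assume h: "h \<in> lists {1..n}" "length h = s" and \<pi>: "\<pi> \<in> load_orders n (load h)"
    show "(\<Sum>i=1..n. pmf p i * ?f (Suc s) (h @ [\<pi> i])) \<le> ?r * ?f s h + ?B"
    proof (cases "bounded_between n \<alpha> M t0 s h")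
      case True
      have "(\<Sum>i=1..n. pmf p i * ?f (Suc s) (h @ [\<pi> i]))
          \<le> (\<Sum>i=1..n. pmf p i * exp (\<theta> * cosh_pot n \<alpha> (h @ [\<pi> i])))"
        by (intro sum_mono mult_left_mono) auto
      also have "\<dots> \<le> ?r * exp (\<theta> * cosh_pot n \<alpha> h) + ?B"
      proof (rule exp_cosh_pot_step[OF h(1) \<pi> a _ \<theta>])
        fix i assume "i \<in> {1..n}"
        then have "exp (\<alpha> * \<bar>dev n (take s h) i\<bar>) \<le> M"
          using True step(1) unfolding bounded_between_def by auto
        then show "exp (\<alpha> * \<bar>dev n h i\<bar>) \<le> M" using h by simp
      qed
      finally show ?thesis using True by simp
    next
      case False
      then obtain r i where "r \<in> {t0..s}" "i \<in> {1..n}" "\<not> exp (\<alpha> * \<bar>dev n (take r h) i\<bar>) \<le> M"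
        by (auto simp: bounded_between_def)
      \<comment> \<open>The offending prefix remains a prefix of every extension, so a discarded
        trajectory contributes zero from then on.\<close>
      then have "\<not> bounded_between n \<alpha> M t0 (Suc s) (h @ [j])" for j
        using h unfolding bounded_between_def by (intro notI) (drule bspec[of _ _ r], auto)
      then show ?thesis using False by simp
    qed
  qed
  also have "\<dots> = ?r * measure_pmf.expectation (allocation \<tau> p s) (?f s) + ?B"
    using integrable_allocation by simp
  also have "\<dots> \<le> ?r * (?r ^ (s - t0) * W + 2 / (\<theta> * \<alpha>) * ?B) + ?B"
    using step.IH r by (intro add_right_mono mult_left_mono) auto
  also have "\<dots> = ?r ^ (Suc s - t0) * W + 2 / (\<theta> * \<alpha>) * ?B"
    using step(1) th a by (simp add: Suc_diff_le field_simps)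
  finally show ?case .
qed

text \<open>Raising to the power \<open>k\<close> trades the parameter \<open>\<alpha>\<close> for
  \<open>k * \<alpha>\<close>, where the mean of the potential is still at most
  \<open>100 * n\<close>; Markov then gains the factor \<open>M ^ k\<close>.\<close>

lemma prob_large_dev_le:
  fixes \<alpha> M :: real
  assumes a: "0 < \<alpha>" "k * \<alpha> \<le> 1 / 100" and k: "k > 0" and M: "M \<ge> 1"
  shows "measure_pmf.prob (allocation \<tau> p s) {h. \<exists>i\<in>{1..n}. exp (\<alpha> * \<bar>dev n h i\<bar>) > M} \<le> 100 * n / M ^ k"
proof -
  let ?P = "allocation \<tau> p s"
  have "measure_pmf.prob ?P {h. \<exists>i\<in>{1..n}. exp (\<alpha> * \<bar>dev n h i\<bar>) > M}
      \<le> measure_pmf.prob ?P {h \<in> space (measure_pmf ?P). cosh_pot n (k * \<alpha>) h \<ge> M ^ k}"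
  proof (intro measure_pmf.finite_measure_mono subsetI)
    fix h assume "h \<in> {h. \<exists>i\<in>{1..n}. exp (\<alpha> * \<bar>dev n h i\<bar>) > M}"
    then obtain i where i: "i \<in> {1..n}" "exp (\<alpha> * \<bar>dev n h i\<bar>) > M" by blast
    have "M ^ k \<le> exp (\<alpha> * \<bar>dev n h i\<bar>) ^ k" using i M by (intro power_mono) auto
    also have "\<dots> = exp (k * \<alpha> * \<bar>dev n h i\<bar>)" by (simp add: exp_of_nat_mult[symmetric] mult.assoc)
    also have "\<dots> \<le> cosh_pot n (k * \<alpha>) h" by (rule exp_abs_dev_le_cosh_pot[OF i(1)])
    finally show "h \<in> {h \<in> space (measure_pmf ?P). cosh_pot n (k * \<alpha>) h \<ge> M ^ k}" by simp
  qed simp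
  also have "\<dots> \<le> measure_pmf.expectation ?P (cosh_pot n (k * \<alpha>)) / M ^ k"
    using M by (intro integral_Markov_inequality_measure[where A = UNIV] integrable_allocation) auto
  also have "\<dots> \<le> 100 * n / M ^ k"
    using expectation_cosh_pot_le[of "k * \<alpha>"] a k M by (intro divide_right_mono) auto
  finally show ?thesis .
qed

text \<open>
  Going back \<open>n\<^sup>2\<close> steps in time makes the influence of the unknown configuration at the start
  negligible, unless the start is the empty configuration.
\<close>

lemma prob_large_cosh_pot_le:
  fixes \<alpha> M \<theta> :: real
  assumes a: "0 < \<alpha>" "\<alpha> \<le> 1 / 100" and M: "M \<ge> 1" and \<theta>: "\<theta> = \<alpha> / (2 * M\<^sup>2)"
    and t: "t \<le> s"
  shows "measure_pmf.prob (allocation \<tau> p s)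
      {h. bounded_between n \<alpha> M (t - n\<^sup>2) s h \<and> cosh_pot n \<alpha> h > 600 * n}
    \<le> (exp (2 * \<theta> * n) + exp (2 * \<theta> * n * M - \<theta> * \<alpha> / 2 * n\<^sup>2)
       + 2 / (\<theta> * \<alpha>) * exp (200 * \<theta> * n + 1)) / exp (600 * \<theta> * n)"
proof -
  let ?P = "allocation \<tau> p s" and ?t0 = "t - n\<^sup>2"
  let ?f = "\<lambda>h. of_bool (bounded_between n \<alpha> M ?t0 s h) * exp (\<theta> * cosh_pot n \<alpha> h)"
  let ?r = "1 - \<theta> * \<alpha> / 2"
  have th: "\<theta> > 0" using a M by (simp add: \<theta>)
  have "\<theta> \<le> \<alpha> / (2 * 1)" unfolding \<theta> using a M by (intro divide_left_mono mult_left_mono) auto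
  then have "\<theta> * \<alpha> \<le> 1 * 1" using th a by (intro mult_mono) auto
  then have r: "?r \<ge> 0" "?r \<le> 1" using th a by auto
  have "measure_pmf.expectation ?P ?f
      \<le> exp (2 * \<theta> * n) + exp (2 * \<theta> * n * M - \<theta> * \<alpha> / 2 * n\<^sup>2) + 2 / (\<theta> * \<alpha>) * exp (200 * \<theta> * n + 1)"
  \<comment> \<open>Subtraction on \<open>nat\<close> truncates, so \<open>?t0 = 0\<close> means
    that the recursion starts at the empty history, of potential \<open>2 * n\<close>.\<close>
  proof (cases "?t0 = 0")
    case True
    have "exp (\<theta> * cosh_pot n \<alpha> h) \<le> exp (2 * \<theta> * n)" if "length h = ?t0" for h
      using that True by (simp add: cosh_pot_def exp_pot_def dev_def load_def)
    then have "measure_pmf.expectation ?P ?f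
        \<le> ?r ^ (s - ?t0) * exp (2 * \<theta> * n) + 2 / (\<theta> * \<alpha>) * exp (200 * \<theta> * n + 1)"
      using t by (intro truncated_exp_moment_le[OF a M \<theta>]) auto
    also have "?r ^ (s - ?t0) * exp (2 * \<theta> * n) \<le> 1 * exp (2 * \<theta> * n)"
      using r by (intro mult_right_mono power_le_one) auto
    also have "\<dots> \<le> exp (2 * \<theta> * n) + exp (2 * \<theta> * n * M - \<theta> * \<alpha> / 2 * n\<^sup>2)" by simp
    finally show ?thesis by simp
  next
    case False
    have "exp (\<theta> * cosh_pot n \<alpha> h) \<le> exp (2 * \<theta> * n * M)"
      if "length h = ?t0" "bounded_between n \<alpha> M ?t0 ?t0 h" for h
    proof -
      have "exp (\<alpha> * \<bar>dev n h i\<bar>) \<le> M" if "i \<in> {1..n}" for i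
        using \<open>bounded_between n \<alpha> M ?t0 ?t0 h\<close> \<open>length h = ?t0\<close> that by (auto simp: bounded_between_def)
      then have "cosh_pot n \<alpha> h \<le> 2 * n * M"
        using cosh_pot_le[of n \<alpha> h M] a by (simp add: cosh_pot_def)
      then show ?thesis using th by simp
    qed
    then have "measure_pmf.expectation ?P ?f
        \<le> ?r ^ (s - ?t0) * exp (2 * \<theta> * n * M) + 2 / (\<theta> * \<alpha>) * exp (200 * \<theta> * n + 1)"
      using t by (intro truncated_exp_moment_le[OF a M \<theta>]) auto
    also have "?r ^ (s - ?t0) * exp (2 * \<theta> * n * M) \<le> exp (2 * \<theta> * n * M - \<theta> * \<alpha> / 2 * n\<^sup>2)"
    proof -
      \<comment> \<open>No truncation happened, so at least \<open>n\<^sup>2\<close> contractions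
        separate \<open>?t0\<close> from \<open>s\<close>.\<close>
      have "?r ^ (s - ?t0) \<le> ?r ^ (n\<^sup>2)" using False t r by (intro power_decreasing) auto
      also have "\<dots> \<le> exp (- (\<theta> * \<alpha> / 2)) ^ (n\<^sup>2)"
        using r exp_ge_add_one_self[of "- (\<theta> * \<alpha> / 2)"] by (intro power_mono) auto
      also have "\<dots> = exp (- (\<theta> * \<alpha> / 2 * n\<^sup>2))"
        by (simp add: exp_of_nat_mult[symmetric] mult_ac)
      finally have "?r ^ (s - ?t0) * exp (2 * \<theta> * n * M) \<le> exp (- (\<theta> * \<alpha> / 2 * n\<^sup>2)) * exp (2 * \<theta> * n * M)"
        by (rule mult_right_mono) simp
      then show ?thesis by (simp add: exp_add[symmetric])
    qed
    also have "\<dots> \<le> exp (2 * \<theta> * n) + exp (2 * \<theta> * n * M - \<theta> * \<alpha> / 2 * n\<^sup>2)" by simp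
    finally show ?thesis by simp
  qed
  note E = this
  have "measure_pmf.prob ?P {h. bounded_between n \<alpha> M ?t0 s h \<and> cosh_pot n \<alpha> h > 600 * n}
      \<le> measure_pmf.prob ?P {h \<in> space (measure_pmf ?P). ?f h \<ge> exp (600 * \<theta> * n)}"
    using th by (intro measure_pmf.finite_measure_mono) auto
  also have "\<dots> \<le> measure_pmf.expectation ?P ?f / exp (600 * \<theta> * n)"
    by (intro integral_Markov_inequality_measure[where A = UNIV] integrable_allocation) auto
  also have "\<dots> \<le> (exp (2 * \<theta> * n) + exp (2 * \<theta> * n * M - \<theta> * \<alpha> / 2 * n\<^sup>2)
       + 2 / (\<theta> * \<alpha>) * exp (200 * \<theta> * n + 1)) / exp (600 * \<theta> * n)"
    using E by (intro divide_right_mono) auto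
  finally show ?thesis .
qed

text \<open>A union bound over the window and the \<open>n\<^sup>2\<close> steps before it. If the
  potential is large at time \<open>s\<close>, either some earlier time in that range, or
  \<open>s\<close> itself, has a term above \<open>M\<close>, or the truncated estimate applies at
  \<open>s\<close>.\<close>

lemma prob_exists_large_cosh_pot_le:
  fixes \<alpha> M \<theta> :: real
  assumes a: "0 < \<alpha>" "k * \<alpha> \<le> 1 / 100" and k: "k > 0" and M: "M \<ge> 1" and \<theta>: "\<theta> = \<alpha> / (2 * M\<^sup>2)"
    and S: "t \<le> S" "real S \<le> t + T"
  shows "measure_pmf.prob (allocation \<tau> p S) {h. \<exists>s\<in>{t..S}. cosh_pot n \<alpha> (take s h) > 600 * n}
    \<le> (real n ^ 2 + T + 1) * (100 * n / M ^ k + (exp (2 * \<theta> * n) + exp (2 * \<theta> * n * M - \<theta> * \<alpha> / 2 * n\<^sup>2)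
       + 2 / (\<theta> * \<alpha>) * exp (200 * \<theta> * n + 1)) / exp (600 * \<theta> * n))"
    (is "_ \<le> _ * (?b1 + ?b2)")
proof -
  let ?t0 = "t - n\<^sup>2"
  let ?prob = "\<lambda>s. measure_pmf.prob (allocation \<tau> p s)"
  \<comment> \<open>The guard \<open>t \<le> s\<close> keeps the second alternative away from the
    warm-up times, where only large terms need to be excluded.\<close>
  define A where "A s h \<longleftrightarrow> (\<exists>i\<in>{1..n}. exp (\<alpha> * \<bar>dev n h i\<bar>) > M)
    \<or> t \<le> s \<and> bounded_between n \<alpha> M ?t0 s h \<and> cosh_pot n \<alpha> h > 600 * n" for s h
  have "1 * \<alpha> \<le> k * \<alpha>" using a k by (intro mult_right_mono) auto
  then have a': "\<alpha> \<le> 1 / 100" using a by linarith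
  have "?prob S {h. \<exists>s\<in>{t..S}. cosh_pot n \<alpha> (take s h) > 600 * n}
      \<le> ?prob S (\<Union>s\<in>{?t0..S}. {h. A s (take s h)})"
  proof (intro measure_pmf.finite_measure_mono subsetI)
    fix h assume "h \<in> {h. \<exists>s\<in>{t..S}. cosh_pot n \<alpha> (take s h) > 600 * n}"
    then obtain s where s: "s \<in> {t..S}" "cosh_pot n \<alpha> (take s h) > 600 * n" by blast
    show "h \<in> (\<Union>s\<in>{?t0..S}. {h. A s (take s h)})"
    proof (cases "bounded_between n \<alpha> M ?t0 s (take s h)")
      case True
      then have "A s (take s h)" using s by (auto simp: A_def)
      then show ?thesis using s by force
    next
      case False
      then obtain r i where ri: "r \<in> {?t0..s}" "i \<in> {1..n}" "exp (\<alpha> * \<bar>dev n (take r (take s h)) i\<bar>) > M"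
        by (auto simp: bounded_between_def not_le)
      then have "A r (take r h)" by (auto simp: A_def min_absorb1)
      then show ?thesis using ri s by force
    qed
  qed simp
  also have "\<dots> \<le> (\<Sum>s\<in>{?t0..S}. ?prob S {h. A s (take s h)})"
    by (intro measure_pmf.finite_measure_subadditive_finite) auto
  also have "\<dots> \<le> (\<Sum>s\<in>{?t0..S}. ?b1 + ?b2)"
  proof (rule sum_mono)
    fix s assume s: "s \<in> {?t0..S}"
    have b2: "?b2 \<ge> 0" using a M by (simp add: \<theta>)
    have "?prob S {h. A s (take s h)} = ?prob s {h. A s h}" using s by (intro prob_take) simp
    also have "\<dots> = ?prob s ({h. \<exists>i\<in>{1..n}. exp (\<alpha> * \<bar>dev n h i\<bar>) > M}
        \<union> {h. t \<le> s \<and> bounded_between n \<alpha> M ?t0 s h \<and> cosh_pot n \<alpha> h > 600 * n})"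
      by (intro arg_cong[where f = "?prob s"]) (auto simp: A_def)
    also have "\<dots> \<le> ?prob s {h. \<exists>i\<in>{1..n}. exp (\<alpha> * \<bar>dev n h i\<bar>) > M}
        + ?prob s {h. t \<le> s \<and> bounded_between n \<alpha> M ?t0 s h \<and> cosh_pot n \<alpha> h > 600 * n}"
      by (intro measure_Un_le) auto
    also have "\<dots> \<le> ?b1 + ?b2"
    proof (rule add_mono)
      show "?prob s {h. \<exists>i\<in>{1..n}. exp (\<alpha> * \<bar>dev n h i\<bar>) > M} \<le> ?b1"
        using a k M by (rule prob_large_dev_le)
      show "?prob s {h. t \<le> s \<and> bounded_between n \<alpha> M ?t0 s h \<and> cosh_pot n \<alpha> h > 600 * n} \<le> ?b2"
      proof (cases "t \<le> s")
        case True
        then show ?thesis using prob_large_cosh_pot_le[OF a(1) a' M \<theta> True] by simp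
      next
        case False
        then show ?thesis using b2 by simp
      qed
    qed
    finally show "?prob S {h. A s (take s h)} \<le> ?b1 + ?b2" .
  qed
  also have "\<dots> = real (Suc S - ?t0) * (?b1 + ?b2)" by simp
  also have "\<dots> \<le> (real n ^ 2 + T + 1) * (?b1 + ?b2)"
  proof (rule mult_right_mono)
    have "Suc S - ?t0 \<le> S + 1 - t + n\<^sup>2" using S by linarith
    then have "real (Suc S - ?t0) \<le> real (S + 1 - t + n\<^sup>2)" by (simp only: of_nat_le_iff)
    also have "\<dots> = real S + 1 - real t + real n ^ 2" using S by (simp add: of_nat_diff)
    finally show "real (Suc S - ?t0) \<le> real n ^ 2 + T + 1" using S by simp
    show "?b1 + ?b2 \<ge> 0" using a M by (simp add: \<theta>)
  qed
  finally show ?thesis .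
qed

end

section \<open>Choice of parameters and conclusion\<close>

lemma Phi0_le_cosh_pot:
  assumes "length h = s"
  shows "Phi0 \<alpha> n (load h) s \<le> n + cosh_pot n \<alpha> h"
proof -
  \<comment> \<open>With the positive part, each exponential is either 1 or the untruncated one,
    hence at most their sum.\<close>
  have "Phi0 \<alpha> n (load h) s \<le> (\<Sum>i=1..n. 1 + exp (\<alpha> * dev n h i))"
    unfolding Phi0_def by (intro sum_mono) (auto simp: max_def dev_def assms)
  also have "\<dots> = n + exp_pot n \<alpha> h" by (simp add: sum.distrib exp_pot_def)
  also have "\<dots> \<le> n + cosh_pot n \<alpha> h" by (simp add: cosh_pot_def)
  finally show ?thesis .
qed

text \<open>The previous bound at \<open>M = n powr (1/5)\<close> and \<open>k = 50\<close>. The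
  first part is of order \<open>n ^ 2 * n / n ^ 10\<close>. In the rest \<open>\<theta> * n\<close>
  grows like \<open>n powr (3/5)\<close>, and the start-up exponent \<open>n powr (4/5)\<close>
  loses to \<open>n powr (8/5)\<close>, so everything else is superpolynomially small.\<close>

lemma eventually_failure_bound:
  "\<forall>\<^sub>F n :: nat in sequentially. 
    (real n ^ 2 + real n * ln (real n) ^ 5 + 1) * (100 * n / real n ^ 10
      + (exp (2 * (real n powr (-2/5) / 10000) * n)
       + exp (2 * (real n powr (-2/5) / 10000) * n * real n powr (1/5) - (real n powr (-2/5) / 10000) * (1/5000) / 2 * n\<^sup>2)
       + 2 / ((real n powr (-2/5) / 10000) * (1/5000)) * exp (200 * (real n powr (-2/5) / 10000) * n + 1))
       / exp (600 * (real n powr (-2/5) / 10000) * n)) \<le> real n powr (-3)"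
  by real_asymp


theorem theorem5p3:
  fixes \<epsilon> \<alpha>\<^sub>2 c :: real
  assumes "\<epsilon> = 1 / 12"
    and "\<alpha>\<^sub>2 = 0.0002"
    and "c = 2 * 40 * 128 ^ 3 * \<epsilon> powi (-7) * 4 * \<alpha>\<^sub>2 powi (-1)"
  shows "\<forall>\<^sub>F n :: nat in sequentially.
    \<forall>(p :: nat pmf) (\<tau> :: nat list \<Rightarrow> (nat \<Rightarrow> nat) pmf) (t :: nat).
      set_pmf p \<subseteq> {1..n} \<longrightarrow>
      mono_on {1..n} (pmf p) \<longrightarrow>
      pmf p (nat \<lfloor>real n / 3\<rfloor>) \<le> (1 - 4 * \<epsilon>) / real n \<longrightarrow>
      pmf p (nat \<lceil>2 * real n / 3\<rceil>) \<ge> (1 + 4 * \<epsilon>) / real n \<longrightarrow>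
      tie_breaking_rule n \<tau> \<longrightarrow>
      measure_pmf.prob (allocation \<tau> p (nat \<lfloor>real t + real n * ln (real n) ^ 5\<rfloor>))
        {h. \<forall>s::nat. t \<le> s \<and> real s \<le> real t + real n * ln (real n) ^ 5 \<longrightarrow>
              Phi0 \<alpha>\<^sub>2 n (load (take s h)) s \<le> 2 * c * real n}
      \<ge> 1 - real n powi (-3)"
  using eventually_failure_bound eventually_ge_at_top[of 9]
proof eventually_elim
  case (elim n)
  define m where "m = n div 3"
  define T where "T = real n * ln (real n) ^ 5"
  define M \<theta> where "M = real n powr (1/5)" and "\<theta> = real n powr (-2/5) / 10000"
  have T: "T \<ge> 0" using elim by (simp add: T_def)
  have a: "\<alpha>\<^sub>2 = 1 / 5000" using assms by simp
  \<comment> \<open>600 for the potential and 1 for the terms equal to 1 in \<open>Phi0\<close>; the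
    actual constant is far larger.\<close>
  have c: "2 * c \<ge> 601" unfolding assms by (simp add: power_int_def)
  have M: "M \<ge> 1" using elim by (simp add: M_def ge_one_powr_ge_zero)
  \<comment> \<open>The power 50 is the largest \<open>k\<close> with
    \<open>k * \<alpha>\<^sub>2 \<le> 1 / 100\<close>.\<close>
  have M50: "M ^ 50 = real n ^ 10"
    using elim by (simp add: M_def powr_powr powr_realpow flip: powr_realpow[of "real n powr _"])
  have "M\<^sup>2 = real n powr (2/5)"
    using elim by (simp add: M_def powr_powr flip: powr_realpow[of "real n powr _"])
  then have \<theta>: "\<theta> = \<alpha>\<^sub>2 / (2 * M\<^sup>2)" using elim by (simp add: \<theta>_def a powr_minus_divide)
  \<comment> \<open>Rounding \<open>n / 3\<close> down and \<open>2 * n / 3\<close> up gives the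
    symmetric ranks \<open>m\<close> and \<open>n - m\<close> of the locale.\<close>
  have floor: "nat \<lfloor>real n / 3\<rfloor> = m"
    using floor_divide_of_nat_eq[of n 3, where 'a = real] by (simp add: m_def)
  have "\<lceil>2 * real n / 3\<rceil> = int (n - m)"
    unfolding m_def ceiling_eq_iff by linarith
  then have ceil: "nat \<lceil>2 * real n / 3\<rceil> = n - m" by simp
  show ?case
  proof (intro allI impI)
    fix p :: "nat pmf" and \<tau> :: "nat list \<Rightarrow> (nat \<Rightarrow> nat) pmf" and t :: nat
    assume p: "set_pmf p \<subseteq> {1..n}" "mono_on {1..n} (pmf p)"
      "pmf p (nat \<lfloor>real n / 3\<rfloor>) \<le> (1 - 4 * \<epsilon>) / real n"
      "pmf p (nat \<lceil>2 * real n / 3\<rceil>) \<ge> (1 + 4 * \<epsilon>) / real n" "tie_breaking_rule n \<tau>"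
    interpret biased_allocation n m p \<tau>
      using elim p unfolding floor ceil assms(1) by unfold_locales (auto simp: m_def)
    \<comment> \<open>The last integer time of the window; a history of \<open>S\<close> balls has
      all relevant states as prefixes.\<close>
    define S where "S = nat \<lfloor>real t + T\<rfloor>"
    have le_S: "s \<le> S" if "real s \<le> t + T" for s
      using that unfolding S_def by (rule le_nat_floor)
    have S: "t \<le> S" "real S \<le> t + T"
      using le_S[of t] of_nat_floor[of "t + T"] T by (simp_all add: S_def)
    let ?P = "allocation \<tau> p S"
    let ?good = "{h. \<forall>s::nat. t \<le> s \<and> real s \<le> t + T \<longrightarrow> Phi0 \<alpha>\<^sub>2 n (load (take s h)) s \<le> 2 * c * real n}"
    have "measure_pmf.prob ?P (- ?good)
        \<le> measure_pmf.prob ?P {h. \<exists>s\<in>{t..S}. cosh_pot n \<alpha>\<^sub>2 (take s h) > 600 * n}"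
    \<comment> \<open>The inclusion is checked on the support only, since it needs
      \<open>length h = S\<close> for \<open>take s h\<close> to have length
      \<open>s\<close>.\<close>
    proof (intro measure_pmf.finite_measure_mono_AE, unfold AE_measure_pmf_iff, intro ballI impI)
      fix h assume h: "h \<in> set_pmf ?P" "h \<in> - ?good"
      then obtain s where s: "t \<le> s" "s \<le> S" "Phi0 \<alpha>\<^sub>2 n (load (take s h)) s > 2 * c * real n"
        using le_S by (auto simp: not_le)
      have "length h = S" using h set_pmf_allocation by blast
      then have "Phi0 \<alpha>\<^sub>2 n (load (take s h)) s \<le> n + cosh_pot n \<alpha>\<^sub>2 (take s h)"
        using s by (intro Phi0_le_cosh_pot) simp
      moreover have "601 * real n \<le> 2 * c * n" using c by (rule mult_right_mono) simp
      ultimately have "cosh_pot n \<alpha>\<^sub>2 (take s h) > 600 * n" using s by simp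
      then show "h \<in> {h. \<exists>s\<in>{t..S}. cosh_pot n \<alpha>\<^sub>2 (take s h) > 600 * n}" using s by auto
    qed simp
    also have "\<dots> \<le> (real n ^ 2 + T + 1) * (100 * n / M ^ 50 + (exp (2 * \<theta> * n) + exp (2 * \<theta> * n * M - \<theta> * \<alpha>\<^sub>2 / 2 * n\<^sup>2)
       + 2 / (\<theta> * \<alpha>\<^sub>2) * exp (200 * \<theta> * n + 1)) / exp (600 * \<theta> * n))"
      by (rule prob_exists_large_cosh_pot_le[OF _ _ _ M \<theta> S]) (auto simp: a)
    also have "\<dots> \<le> real n powr (-3)"
      using elim(1) unfolding M50 unfolding M_def \<theta>_def T_def a .
    also have "\<dots> = real n powi (-3)" using powr_real_of_int'[of n "-3"] elim by simp
    finally show "measure_pmf.prob (allocation \<tau> p (nat \<lfloor>real t + real n * ln (real n) ^ 5\<rfloor>))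
        {h. \<forall>s::nat. t \<le> s \<and> real s \<le> real t + real n * ln (real n) ^ 5 \<longrightarrow>
              Phi0 \<alpha>\<^sub>2 n (load (take s h)) s \<le> 2 * c * real n} \<ge> 1 - real n powi (-3)"
      using measure_pmf.prob_compl[of ?good ?P] by (simp add: S_def T_def Compl_eq_Diff_UNIV)
  qed
qed

end
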